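(* Let $d\ge2$, $K\ge1$ be integers, $J\ge0$ real and $\epsilon>0$. Let $|\Psi\rangle\in(\mathbb C^d)^{\otimes K}$ be a unit vector chosen uniformly at random (unitarily invariant measure), and $F^{(K,J)}_\Psi:=\langle\Psi|\mathcal E^{(K)}_J(|\Psi\rangle\langle\Psi|)|\Psi\rangle$. Then $$\mathrm{Prob}\big[F^{(K,J)}_\Psi<1-\epsilon\big]<\frac{2(K+1)^{\frac{d(d-1)}{2}}}{\epsilon}\exp\!\Big[-\frac{2J^2}{K}\Big].$$
   Context: Use the Schur–Weyl decomposition $(\mathbb C^d)^{\otimes K}\cong\bigoplus_{\lambda\in\mathsf Y_{K,d}}\mathcal R_\lambda\otimes\mathcal M_\lambda$, where $\mathsf Y_{K,d}$ is the set of Young diagrams $\lambda=(\lambda_1\ge\dots\ge\lambda_d\ge0)$ with $\sum_i\lambda_i=K$, $\mathcal R_\lambda$ carries the irreducible $SU(d)$-representation of highest weight $\lambda$ (on which $U^{\otimes K}$ acts irreducibly) and $\mathcal M_\lambda$ is the multiplicity space. Let $\mathsf Y^{(K)}_J:=\{\lambda\in\mathsf Y_{K,d}:\lambda_d\ge K/d-J\}$, $\mathcal H^{(K)}_J:=\bigoplus_{\lambda\in\mathsf Y^{(K)}_J}\mathcal R_\lambda\otimes\mathcal M_\lambda$, $P^{(K)}_J$ its orthogonal projector, $\rho_0$ a fixed density matrix supported in $\mathcal H^{(K)}_J$, and $\mathcal E^{(K)}_J(\rho):=P^{(K)}_J\rho P^{(K)}_J+\mathrm{Tr}[(I-P^{(K)}_J)\rho]\rho_0$.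 *)

theory Defs
  imports "HOL-Analysis.Analysis" "HOL-Probability.Probability"
begin

text \<open>(C^d)^{\<otimes>K} is modelled as complex^('k \<Rightarrow> 'd), with CARD('k) = K tensor
  factors and CARD('d) = d; the computational basis |f> is indexed by f :: 'k \<Rightarrow> 'd.
  The order on 'd fixes the labelling 1 < 2 < ... < d of the single-site basis.\<close>

definition cinner :: "complex^'n \<Rightarrow> complex^'n \<Rightarrow> complex" where
  "cinner x y = (\<Sum>i\<in>UNIV. cnj (x$i) * y$i)"

definition cadj :: "complex^'n^'m \<Rightarrow> complex^'m^'n" where
  "cadj A = (\<chi> i j. cnj (A$j$i))"

definition unitary_mat :: "complex^'n^'n \<Rightarrow> bool" where
  "unitary_mat A \<longleftrightarrow> A ** cadj A = mat 1 \<and> cadj A ** A = mat 1"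

definition ctrace :: "complex^'n^'n \<Rightarrow> complex" where
  "ctrace A = (\<Sum>i\<in>UNIV. A$i$i)"

definition cscale :: "complex \<Rightarrow> complex^'n^'m \<Rightarrow> complex^'n^'m" where
  "cscale c A = (\<chi> i j. c * A$i$j)"

definition outer :: "complex^'n \<Rightarrow> complex^'n^'n" where
  "outer \<psi> = (\<chi> i j. \<psi>$i * cnj (\<psi>$j))"

definition tensor_power :: "complex^'d^'d \<Rightarrow> complex^('k::finite \<Rightarrow> 'd::finite) \<Rightarrow> complex^('k \<Rightarrow> 'd)" where
  "tensor_power U \<psi> = (\<chi> f. \<Sum>g\<in>UNIV. (\<Prod>k\<in>UNIV. U$(f k)$(g k)) * \<psi>$g)"

definition weight_of :: "('k::finite \<Rightarrow> 'd) \<Rightarrow> 'd \<Rightarrow> nat" where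
  "weight_of f i = card {k. f k = i}"

text \<open>Raising operator \<Sum>_k E_{ab}^{(k)} with E_{ab}|b> = |a> (Lie algebra action of gl(d)).\<close>
definition raising :: "'d \<Rightarrow> 'd \<Rightarrow> complex^('k::finite \<Rightarrow> 'd::finite) \<Rightarrow> complex^('k \<Rightarrow> 'd)" where
  "raising a b \<psi> = (\<chi> f. \<Sum>k\<in>UNIV. if f k = a then \<psi> $ (f(k := b)) else 0)"

definition hw_vector :: "('d::{finite,linorder} \<Rightarrow> nat) \<Rightarrow> complex^('k::finite \<Rightarrow> 'd) \<Rightarrow> bool" where
  "hw_vector lam \<psi> \<longleftrightarrow> (\<forall>f. \<psi>$f \<noteq> 0 \<longrightarrow> weight_of f = lam) \<and> (\<forall>a b. a < b \<longrightarrow> raising a b \<psi> = 0)"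

text \<open>Isotypic component R_lam \<otimes> M_lam: the U(d)-submodule generated by highest weight
  vectors of weight lam.\<close>
definition isotypic :: "('d::{finite,linorder} \<Rightarrow> nat) \<Rightarrow> (complex^('k::finite \<Rightarrow> 'd)) set" where
  "isotypic lam = vec.span {tensor_power U \<psi> | U \<psi>. unitary_mat U \<and> hw_vector lam \<psi>}"

definition young_diagrams :: "('d::{finite,linorder} \<Rightarrow> nat) set" where
  "young_diagrams = {lam. (\<forall>a b. a \<le> b \<longrightarrow> lam b \<le> lam a)}"

definition YJ :: "'k::finite itself \<Rightarrow> real \<Rightarrow> ('d::{finite,linorder} \<Rightarrow> nat) set" where
  "YJ _ J = {lam \<in> young_diagrams. sum lam UNIV = CARD('k) \<and>
      real (lam (Max UNIV)) \<ge> real CARD('k) / real CARD('d) - J}"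

definition HJ :: "real \<Rightarrow> (complex^('k::finite \<Rightarrow> 'd::{finite,linorder})) set" where
  "HJ J = vec.span (\<Union>lam\<in>YJ TYPE('k) J. isotypic lam)"

definition orth_proj :: "(complex^'n) set \<Rightarrow> complex^'n \<Rightarrow> complex^'n" where
  "orth_proj H \<psi> = (THE p. p \<in> H \<and> (\<forall>h\<in>H. cinner h (\<psi> - p) = 0))"

definition proj_mat :: "(complex^'n) set \<Rightarrow> complex^'n^'n" where
  "proj_mat H = (\<chi> i j. orth_proj H (axis j 1) $ i)"

definition PJ :: "real \<Rightarrow> complex^('k::finite \<Rightarrow> 'd::{finite,linorder})^('k \<Rightarrow> 'd)" where
  "PJ J = proj_mat (HJ J)"

definition density_matrix :: "complex^'n^'n \<Rightarrow> bool" where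
  "density_matrix \<rho> \<longleftrightarrow> cadj \<rho> = \<rho> \<and> (\<forall>v. Re (cinner v (\<rho> *v v)) \<ge> 0) \<and> ctrace \<rho> = 1"

definition channel :: "complex^'n^'n \<Rightarrow> complex^'n^'n \<Rightarrow> complex^'n^'n \<Rightarrow> complex^'n^'n" where
  "channel P \<rho>0 \<rho> = P ** \<rho> ** P + cscale (ctrace ((mat 1 - P) ** \<rho>)) \<rho>0"

definition fidelity :: "complex^'n^'n \<Rightarrow> complex^'n^'n \<Rightarrow> complex^'n \<Rightarrow> complex" where
  "fidelity P \<rho>0 \<psi> = cinner \<psi> (channel P \<rho>0 (outer \<psi>) *v \<psi>)"

end

theory Submission
  imports Defs
begin

text \<open>
  With \<open>N\<close> the orthogonal complement of \<open>H_J\<close> and \<open>q\<close> the squared norm of the \<open>N\<close>-part of \<open>\<psi>\<close>, the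
  fidelity is at least \<open>(1 - q)\<^sup>2 \<ge> 1 - 2 q\<close>, and unitary invariance makes the mean of \<open>q\<close> equal to
  \<open>dim N / d^K\<close>; so Markov's inequality reduces the claim to a bound on \<open>dim N\<close>.

  \<open>N\<close> is invariant under unitary tensor powers, hence, by differentiation, under the raising operators
  \<open>E_{ab}\<close>. Each of these \<open>d (d - 1) / 2\<close> operators is nilpotent of index at most \<open>K + 1\<close>, so passing to its
  kernel divides the dimension by at most \<open>K + 1\<close>. What remains is the space of highest weight vectors in
  \<open>N\<close>, which embeds into the coordinates \<open>f\<close> whose number of entries \<open>d\<close> is below \<open>K/d - J\<close>: a weight component
  of any other weight would lie in \<open>H_J\<close>. Hoeffding's bound counts those coordinates. The constant \<open>dim\<close>
  is the real dimension, twice the complex one.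
\<close>

section \<open>Dimensions of kernels and images\<close>

text \<open>Rank-nullity relative to a subspace: the orthogonal complement of the kernel inside
  \<open>S\<close> meets the kernel only in 0, so \<open>f\<close> is injective on it.\<close>

lemma dim_le_dim_kernel_plus_dim_image:
  fixes f :: "'a::euclidean_space \<Rightarrow> 'a"
  assumes f: "linear f" and S: "subspace S"
  shows "dim S \<le> dim {x \<in> S. f x = 0} + dim (f ` S)"
proof -
  let ?K = "{x \<in> S. f x = 0}"
  let ?C = "{y \<in> S. \<forall>x\<in>?K. orthogonal x y}"
  have K: "subspace ?K"
    using S f by (auto simp: subspace_def linear_add linear_scale linear_0)
  have C: "subspace ?C"
    using S by (auto simp: subspace_def orthogonal_def inner_simps)
  have "inj_on f ?C"
  proof (rule inj_onI)
    fix x y assume xy: "x \<in> ?C" "y \<in> ?C" "f x = f y"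
    then have "x - y \<in> ?C" using C by (intro subspace_diff)
    moreover have "x - y \<in> ?K"
      using xy S f by (simp add: linear_diff subspace_diff)
    ultimately have "orthogonal (x - y) (x - y)" by blast
    then show "x = y" by (simp add: orthogonal_self)
  qed
  then have "dim (f ` ?C) = dim ?C"
    using C by (intro dim_image_eq f) (simp add: span_eq_iff[THEN iffD2])
  moreover have "dim (f ` ?C) \<le> dim (f ` S)" by (intro dim_subset) auto
  moreover have "dim ?C + dim ?K = dim S"
    by (rule dim_subspace_orthogonal_to_vectors[OF K S]) auto
  ultimately show ?thesis by linarith
qed

text \<open>The image of \<open>S\<close> is again invariant, has nilpotency index one less, and its
  kernel lies in the kernel on \<open>S\<close>. Hence each passage to the image costs at most one
  kernel dimension.\<close>

lemma dim_nilpotent_le: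
  fixes f :: "'a::euclidean_space \<Rightarrow> 'a"
  assumes f: "linear f"
    and "subspace S" and "f ` S \<subseteq> S" and "\<And>x. x \<in> S \<Longrightarrow> (f ^^ m) x = 0"
  shows "dim S \<le> m * dim {x \<in> S. f x = 0}"
  using assms(2-4)
proof (induction m arbitrary: S)
  case 0
  then have "S \<subseteq> {0}" by auto
  then show ?case using dim_subset[of S "{0}"] by simp
next
  case (Suc m)
  have "(f ^^ m) x = 0" if "x \<in> f ` S" for x
    using that Suc.prems(3) by (auto simp del: funpow.simps simp: funpow_Suc_right)
  then have "dim (f ` S) \<le> m * dim {x \<in> f ` S. f x = 0}"
    using Suc.prems by (intro Suc.IH linear_subspace_image f) auto
  also have "\<dots> \<le> m * dim {x \<in> S. f x = 0}"
    using Suc.prems(2) by (intro mult_left_mono dim_subset) auto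
  finally show ?case
    using dim_le_dim_kernel_plus_dim_image[OF f Suc.prems(1)] by simp
qed

subsection \<open>Raising operators and weights\<close>

lemma raising_nth: "raising a b \<psi> $ f = (\<Sum>k\<in>UNIV. if f k = a then \<psi> $ (f(k := b)) else 0)"
  by (simp add: raising_def)

lemma linear_raising: "linear (raising a b)"
  by (rule linearI) (auto simp: vec_eq_iff raising_nth scaleR_sum_right
      simp flip: sum.distrib intro!: sum.cong)

lemma raising_self: "raising a a \<psi> $ f = of_nat (weight_of f a) * \<psi> $ f"
proof -
  have "raising a a \<psi> $ f = (\<Sum>k\<in>UNIV. if f k = a then \<psi> $ f else 0)"
    unfolding raising_nth by (rule sum.cong) (auto simp: fun_upd_idem)
  also have "\<dots> = of_nat (card {k. f k = a}) * \<psi> $ f"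
    by (simp add: sum.If_cases)
  finally show ?thesis by (simp add: weight_of_def)
qed

text \<open>The two operators act either on the same site, where matrix units multiply, or on two
  distinct sites. Isolating the second case prepares its cancellation in the commutator.\<close>

lemma raising_raising:
  "raising a b (raising c e \<psi>) $ f =
     (if b = c then raising a e \<psi> $ f else 0) +
     (\<Sum>k\<in>UNIV. \<Sum>l\<in>UNIV - {k}. if f k = a \<and> f l = c then \<psi> $ (f(k := b, l := e)) else 0)"
proof -
  have "raising a b (raising c e \<psi>) $ f =
    (\<Sum>k\<in>UNIV. (if b = c then if f k = a then \<psi> $ (f(k := e)) else 0 else 0) +
      (\<Sum>l\<in>UNIV - {k}. if f k = a \<and> f l = c then \<psi> $ (f(k := b, l := e)) else 0))"
    unfolding raising_nth
  proof (rule sum.cong[OF refl])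
    fix k
    have "(\<Sum>l\<in>UNIV. if (f(k := b)) l = c then \<psi> $ (f(k := b, l := e)) else 0) =
      (if b = c then \<psi> $ (f(k := e)) else 0) +
      (\<Sum>l\<in>UNIV - {k}. if f l = c then \<psi> $ (f(k := b, l := e)) else 0)"
      \<comment> \<open>The summand \<open>l = k\<close> survives only for \<open>b = c\<close>, and
        there the second update at \<open>k\<close> overwrites the first.\<close>
      by (subst sum.remove[of _ k]) (auto intro!: sum.cong)
    then show "(if f k = a then \<Sum>l\<in>UNIV. if (f(k := b)) l = c then \<psi> $ (f(k := b, l := e)) else 0
        else 0) =
      (if b = c then if f k = a then \<psi> $ (f(k := e)) else 0 else 0) +
      (\<Sum>l\<in>UNIV - {k}. if f k = a \<and> f l = c then \<psi> $ (f(k := b, l := e)) else 0)"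
      by auto
  qed
  then show ?thesis
    by (simp add: sum.distrib raising_nth)
qed

text \<open>These are the commutation relations of gl(d): operators on distinct sites commute, so
  only the same-site terms remain.\<close>

lemma raising_commutator:
  "raising a b (raising c e \<psi>) - raising c e (raising a b \<psi>) =
     (if b = c then raising a e \<psi> else 0) - (if e = a then raising c b \<psi> else 0)"
proof (subst vec_eq_iff, intro allI)
  fix f
  have "(\<Sum>k\<in>UNIV. \<Sum>l\<in>UNIV - {k}. if f k = a \<and> f l = c then \<psi> $ (f(k := b, l := e)) else 0) =
    (\<Sum>l\<in>UNIV. \<Sum>k\<in>UNIV - {l}. if f k = a \<and> f l = c then \<psi> $ (f(k := b, l := e)) else 0)"
    using sum.swap_restrict[of UNIV UNIV
      "\<lambda>k l. if f k = a \<and> f l = c then \<psi> $ (f(k := b, l := e)) else 0" "\<lambda>k l. l \<noteq> k"]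
    by (simp add: set_diff_eq eq_commute)
  also have "\<dots> = (\<Sum>l\<in>UNIV. \<Sum>k\<in>UNIV - {l}. if f l = c \<and> f k = a then \<psi> $ (f(l := e, k := b)) else 0)"
    by (intro sum.cong refl) (auto simp: fun_upd_twist)
  finally show "(raising a b (raising c e \<psi>) - raising c e (raising a b \<psi>)) $ f =
     ((if b = c then raising a e \<psi> else 0) - (if e = a then raising c b \<psi> else 0)) $ f"
    by (simp add: raising_raising)
qed

lemma weight_of_fun_upd_Suc:
  assumes "f k = a" "a \<noteq> b"
  shows "weight_of f a = Suc (weight_of (f(k := b)) a)"
proof -
  have "{l. f l = a} = insert k {l. (f(k := b)) l = a}" using assms by auto
  then show ?thesis using assms by (simp add: weight_of_def)
qed

text \<open>Each application replaces one letter \<open>a\<close> of the index by \<open>b\<close>,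
  so \<open>m\<close> nonvanishing applications consume \<open>m\<close> sites carrying
  \<open>a\<close>.\<close>

lemma raising_funpow_nonzero:
  assumes "a \<noteq> b" "(raising a b ^^ m) \<psi> $ f \<noteq> 0"
  shows "m \<le> weight_of f a"
  using assms(2)
proof (induction m arbitrary: f)
  case (Suc m)
  then obtain k where "f k = a" "(raising a b ^^ m) \<psi> $ (f(k := b)) \<noteq> 0"
    by (fastforce simp: raising_nth elim!: sum.not_neutral_contains_not_neutral split: if_splits)
  with Suc.IH show ?case using weight_of_fun_upd_Suc[OF _ assms(1), of f k] by fastforce
qed simp

lemma weight_of_le: "weight_of (f :: 'k::finite \<Rightarrow> 'd) a \<le> CARD('k)"
  by (simp add: weight_of_def card_mono)

lemma raising_nilpotent:
  fixes \<psi> :: "complex^('k::finite \<Rightarrow> 'd::finite)"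
  assumes "a \<noteq> b"
  shows "(raising a b ^^ (CARD('k) + 1)) \<psi> = 0"
proof (rule ccontr)
  assume "\<not> ?thesis"
  then obtain f where "(raising a b ^^ (CARD('k) + 1)) \<psi> $ f \<noteq> 0"
    by (auto simp only: vec_eq_iff zero_index)
  from raising_funpow_nonzero[OF assms this] weight_of_le[of f a] show False by simp
qed

lemma sum_weight_of:
  fixes f :: "'k::finite \<Rightarrow> 'd::finite"
  shows "sum (weight_of f) UNIV = CARD('k)"
proof -
  have "sum (weight_of f) UNIV = card (\<Union>i. {k. f k = i})"
    unfolding weight_of_def by (subst card_UN_disjoint) auto
  also have "(\<Union>i. {k. f k = i}) = UNIV" by auto
  finally show ?thesis by simp
qed

text \<open>The adjoint of E_{ab} is E_{ba}: for each site, changing its letter from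
  \<open>a\<close> to \<open>b\<close> is a bijection between the indices that contribute on the two
  sides.\<close>

lemma cinner_raising: "cinner \<phi> (raising a b \<psi>) = cinner (raising b a \<phi>) \<psi>"
proof -
  have "cinner \<phi> (raising a b \<psi>) =
    (\<Sum>k\<in>UNIV. \<Sum>f\<in>{f. f k = a}. cnj (\<phi> $ f) * \<psi> $ (f(k := b)))"
    unfolding cinner_def raising_nth sum_distrib_left
    by (subst sum.swap) (auto intro!: sum.cong simp: sum.inter_filter[of UNIV, simplified] if_distrib cong: if_cong)
  also have "\<dots> = (\<Sum>k\<in>UNIV. \<Sum>f\<in>{f. f k = b}. cnj (\<phi> $ (f(k := a))) * \<psi> $ f)"
    by (intro sum.cong refl sum.reindex_bij_witness[of _ "\<lambda>f. f(k := a)" "\<lambda>f. f(k := b)" for k])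
      (auto simp: fun_upd_idem)
  also have "\<dots> = cinner (raising b a \<phi>) \<psi>"
    unfolding cinner_def raising_nth cnj_sum sum_distrib_right
    by (subst sum.swap) (auto intro!: sum.cong simp: sum.inter_filter[of UNIV, simplified] if_distrib cong: if_cong)
  finally show ?thesis .
qed

lemma weight_of_fun_upd:
  assumes "f k = a" "a \<noteq> b"
  shows "weight_of (f(k := b)) =
    (weight_of f)(a := weight_of f a - 1, b := weight_of f b + 1)"
proof
  fix i
  have "weight_of (f(k := b)) b = Suc (weight_of f b)"
    using weight_of_fun_upd_Suc[of "f(k := b)" k b a] assms by (auto simp: fun_upd_idem)
  moreover have "weight_of (f(k := b)) i = weight_of f i" if "i \<noteq> a" "i \<noteq> b"
    unfolding weight_of_def using that assms by (intro arg_cong[of _ _ card]) auto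
  ultimately show "weight_of (f(k := b)) i =
    ((weight_of f)(a := weight_of f a - 1, b := weight_of f b + 1)) i"
    using weight_of_fun_upd_Suc[of f k a b] assms by auto
qed

section \<open>Weight components and dominance of highest weights\<close>

definition weight_component ::
  "('d \<Rightarrow> nat) \<Rightarrow> complex^('k::finite \<Rightarrow> 'd::finite) \<Rightarrow> complex^('k \<Rightarrow> 'd)" where
  "weight_component lam \<psi> = (\<chi> f. if weight_of f = lam then \<psi> $ f else 0)"

text \<open>All terms of the sum at \<open>f\<close> come from indices of one and the same weight.
  The truncated subtraction is harmless: if \<open>a\<close> does not occur in \<open>f\<close>,
  both sides are 0.\<close>

lemma raising_weight_component:
  assumes "a \<noteq> b"
  shows "raising a b (weight_component lam \<psi>) $ f =
    (if (weight_of f)(a := weight_of f a - 1, b := weight_of f b + 1) = lam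
     then raising a b \<psi> $ f else 0)"
  unfolding raising_nth weight_component_def
  by (auto simp: weight_of_fun_upd[OF _ assms] intro!: sum.cong sum.neutral)

lemma hw_vector_weight_component:
  assumes "\<And>a b. a < b \<Longrightarrow> raising a b \<psi> = 0"
  shows "hw_vector lam (weight_component lam \<psi>)"
  unfolding hw_vector_def
proof (intro conjI allI impI)
  show "weight_of f = lam" if "weight_component lam \<psi> $ f \<noteq> 0" for f
    using that by (auto simp: weight_component_def split: if_splits)
  show "raising a b (weight_component lam \<psi>) = 0" if "a < b" for a b
    using that assms[OF that] by (auto simp: vec_eq_iff raising_weight_component)
qed

lemma cinner_self: "cinner x x = of_real ((norm x)\<^sup>2)"
  unfolding cinner_def norm_vec_def L2_set_def
  by (simp add: sum_nonneg mult.commute flip: complex_norm_square)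

text \<open>Since E_{ab} kills \<open>\<psi>\<close> and [E_{ab}, E_{ba}] = E_{aa} - E_{bb}, the
  squared norm of E_{ba} \<open>\<psi>\<close> is \<open>lam a - lam b\<close> times that of
  \<open>\<psi>\<close>. Nonnegativity of the norm gives the order.\<close>

lemma hw_vector_antimono:
  assumes hw: "hw_vector lam \<psi>" and nz: "\<psi> \<noteq> 0" and "a \<le> b"
  shows "lam b \<le> lam a"
proof (cases "a = b")
  case False
  with assms have 0: "raising a b \<psi> = 0" by (simp add: hw_vector_def)
  have self: "raising c c \<psi> = of_nat (lam c) *s \<psi>" for c
    using hw by (auto simp: vec_eq_iff raising_self hw_vector_def)
  have "of_real ((norm (raising b a \<psi>))\<^sup>2) = cinner \<psi> (raising a b (raising b a \<psi>))"
    by (simp add: cinner_raising cinner_self)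
  also have "raising a b (raising b a \<psi>) = raising a a \<psi> - raising b b \<psi>"
    using raising_commutator[of a b b a \<psi>] by (simp add: 0 linear_0[OF linear_raising])
  also have "cinner \<psi> \<dots> = (of_nat (lam a) - of_nat (lam b)) * cinner \<psi> \<psi>"
    by (simp add: self cinner_def sum_distrib_left sum_subtractf algebra_simps)
  also have "\<dots> = of_real ((real (lam a) - real (lam b)) * (norm \<psi>)\<^sup>2)"
    by (simp add: cinner_self)
  finally have "(norm (raising b a \<psi>))\<^sup>2 = (real (lam a) - real (lam b)) * (norm \<psi>)\<^sup>2"
    by (simp only: of_real_eq_iff)
  then have "0 \<le> (real (lam a) - real (lam b)) * (norm \<psi>)\<^sup>2"
    by (metis zero_le_power2)
  with nz show ?thesis by (simp add: zero_le_mult_iff)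
qed simp

subsection \<open>Tensor powers of unitaries and the orthogonal complement of \<open>H_J\<close>\<close>

lemma cinner_add_right: "cinner x (y + z) = cinner x y + cinner x z"
  by (simp add: cinner_def algebra_simps sum.distrib)

lemma cinner_scale_right: "cinner x (c *s y) = c * cinner x y"
  by (simp add: cinner_def sum_distrib_left algebra_simps)

lemma cinner_add_left: "cinner (x + y) z = cinner x z + cinner y z"
  by (simp add: cinner_def algebra_simps sum.distrib)

lemma cinner_diff_right: "cinner x (y - z) = cinner x y - cinner x z"
  by (simp add: cinner_def algebra_simps sum_subtractf)

lemma cinner_scale_left: "cinner (c *s x) y = cnj c * cinner x y"
  by (simp add: cinner_def sum_distrib_left algebra_simps)

lemma cinner_commute: "cinner x y = cnj (cinner y x)"
  by (simp add: cinner_def mult.commute)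

lemma cinner_zero_right [simp]: "cinner x 0 = 0"
  by (simp add: cinner_def)

lemma Re_cinner: "Re (cinner x y) = inner x y"
  by (simp add: cinner_def inner_vec_def inner_complex_def)

definition orth_compl :: "(complex^'n) set \<Rightarrow> (complex^'n) set" where
  "orth_compl H = {n. \<forall>h\<in>H. cinner h n = 0}"

lemma subspace_orth_compl: "vec.subspace (orth_compl H)"
  by (auto simp: vec.subspace_def orth_compl_def cinner_add_right cinner_scale_right)

text \<open>Bridges the complex spans in the definition of \<open>HJ\<close> to the real notions
  \<open>dim\<close> and orthonormal basis.\<close>

lemma vec_subspace_imp_subspace:
  fixes S :: "(complex^'n) set"
  assumes "vec.subspace S"
  shows "subspace S"
proof -
  have "r *\<^sub>R x = of_real r *s x" for r and x :: "complex^'n"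
    by (simp add: vec_eq_iff scaleR_conv_of_real[where 'a = complex])
  with assms show ?thesis unfolding vec.subspace_def subspace_def by metis
qed

lemma tensor_power_nth:
  "tensor_power U \<psi> $ f = (\<Sum>g\<in>UNIV. (\<Prod>k\<in>UNIV. U$(f k)$(g k)) * \<psi>$g)"
  by (simp add: tensor_power_def)

lemma tensor_power_add: "tensor_power U (x + y) = tensor_power U x + tensor_power U y"
  by (simp add: vec_eq_iff tensor_power_nth algebra_simps sum.distrib)

lemma tensor_power_scale: "tensor_power U (c *s x) = c *s tensor_power U x"
  by (simp add: vec_eq_iff tensor_power_nth sum_distrib_left algebra_simps)

lemma subspace_tensor_power_vimage:
  "vec.subspace S \<Longrightarrow> vec.subspace {x. tensor_power U x \<in> S}"
  unfolding vec.subspace_def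
  by (auto simp: tensor_power_add tensor_power_scale)
     (metis tensor_power_scale vec.scale_zero_left)

text \<open>Distributivity over independent choices at each site, used for composing tensor powers
  and for factorising an exponential moment.\<close>

lemma sum_prod_swap:
  fixes F :: "'k::finite \<Rightarrow> 'd::finite \<Rightarrow> 'a::comm_semiring_1"
  shows "(\<Sum>g\<in>UNIV. \<Prod>k\<in>UNIV. F k (g k)) = (\<Prod>k\<in>UNIV. \<Sum>i\<in>UNIV. F k i)"
  using prod_sum_PiE[of "UNIV :: 'k set" "\<lambda>_. UNIV :: 'd set" F] by (simp add: PiE_UNIV_domain)

lemma tensor_power_mult: "tensor_power U (tensor_power V \<psi>) = tensor_power (U ** V) \<psi>"
proof (subst vec_eq_iff, intro allI)
  fix f
  have "tensor_power U (tensor_power V \<psi>) $ f =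
    (\<Sum>g\<in>UNIV. (\<Sum>h\<in>UNIV. \<Prod>k\<in>UNIV. U$(f k)$(h k) * V$(h k)$(g k)) * \<psi>$g)"
    unfolding tensor_power_nth sum_distrib_left sum_distrib_right prod.distrib
    by (subst sum.swap) (simp add: mult_ac)
  also have "\<dots> = tensor_power (U ** V) \<psi> $ f"
    unfolding tensor_power_nth
    by (simp add: sum_prod_swap[of "\<lambda>k i. U$(f k)$i * V$i$(g k)" for g] matrix_matrix_mult_def)
  finally show "tensor_power U (tensor_power V \<psi>) $ f = tensor_power (U ** V) \<psi> $ f" .
qed

lemma cinner_tensor_power: "cinner x (tensor_power U y) = cinner (tensor_power (cadj U) x) y"
  unfolding cinner_def tensor_power_nth cadj_def vec_lambda_beta sum_distrib_left cnj_sum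
    sum_distrib_right
  by (subst sum.swap) (simp add: mult_ac)

lemma tensor_power_one:
  fixes \<psi> :: "complex^('k::finite \<Rightarrow> 'd::finite)"
  shows "tensor_power (mat 1) \<psi> = \<psi>"
proof (subst vec_eq_iff, intro allI)
  fix f :: "'k \<Rightarrow> 'd"
  have "(\<Prod>k\<in>UNIV. (mat 1 :: complex^'d^'d)$(f k)$(g k)) = (if g = f then 1 else 0)" for g
    by (auto simp: mat_def fun_eq_iff eq_commute[of "g _"])
  then show "tensor_power (mat 1) \<psi> $ f = \<psi> $ f"
    by (simp add: tensor_power_nth if_distrib[of "\<lambda>c. c * _"] cong: if_cong)
qed

lemma cadj_cadj [simp]: "cadj (cadj A) = A"
  by (simp add: cadj_def vec_eq_iff)

lemma cadj_mult: "cadj (A ** B) = cadj B ** cadj A"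
  by (simp add: cadj_def vec_eq_iff matrix_matrix_mult_def mult.commute)

lemma unitary_mat_cadj: "unitary_mat U \<Longrightarrow> unitary_mat (cadj U)"
  by (simp add: unitary_mat_def)

lemma unitary_mat_mult:
  assumes "unitary_mat U" "unitary_mat V" shows "unitary_mat (U ** V)"
proof -
  have "U ** V ** (cadj V ** cadj U) = U ** (V ** cadj V) ** cadj U"
    "cadj V ** cadj U ** (U ** V) = cadj V ** (cadj U ** U) ** V"
    by (simp_all add: matrix_mul_assoc)
  with assms show ?thesis by (simp add: unitary_mat_def cadj_mult matrix_mul_rid)
qed

lemma unitary_mat_one: "unitary_mat (mat 1)"
proof -
  have "cadj (mat 1) = (mat 1 :: complex^'a^'a)"
    by (auto simp: cadj_def mat_def vec_eq_iff)
  then show ?thesis by (simp add: unitary_mat_def)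
qed

text \<open>Composing with \<open>U\<close> permutes the generators, because a product of unitaries
  is unitary.\<close>

lemma tensor_power_isotypic:
  fixes x :: "complex^('k::finite \<Rightarrow> 'd::{finite,linorder})"
  assumes "unitary_mat U" "x \<in> isotypic lam"
  shows "tensor_power U x \<in> isotypic lam"
proof -
  have "isotypic lam \<subseteq> {x :: complex^('k \<Rightarrow> 'd). tensor_power U x \<in> isotypic lam}"
    unfolding isotypic_def
  proof (intro vec.span_minimal subspace_tensor_power_vimage vec.subspace_span)
    show "{tensor_power V \<psi> |V \<psi>. unitary_mat V \<and> hw_vector lam \<psi>} \<subseteq>
      {x :: complex^('k \<Rightarrow> 'd). tensor_power U x \<in>
      vec.span {tensor_power V \<psi> |V \<psi>. unitary_mat V \<and> hw_vector lam \<psi>}}"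
    proof clarify
      fix V :: "complex^('d::{finite,linorder})^('d::{finite,linorder})" and \<psi> :: "complex^('k \<Rightarrow> 'd)"
      assume "unitary_mat V" "hw_vector lam \<psi>"
      then show "tensor_power U (tensor_power V \<psi>) \<in>
        vec.span {tensor_power V \<psi> |V \<psi>. unitary_mat V \<and> hw_vector lam \<psi>}"
        unfolding tensor_power_mult using unitary_mat_mult[OF assms(1)]
        by (intro vec.span_base) blast
    qed
  qed
  with assms(2) show ?thesis by blast
qed

lemma subspace_HJ: "vec.subspace (HJ J)"
  unfolding HJ_def by (rule vec.subspace_span)

lemma tensor_power_HJ:
  assumes "unitary_mat U" "x \<in> HJ J"
  shows "tensor_power U x \<in> HJ J"
proof -
  have "HJ J \<subseteq> {x. tensor_power U x \<in> HJ J}"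
    unfolding HJ_def
    by (intro vec.span_minimal subspace_tensor_power_vimage vec.subspace_span)
      (auto intro!: vec.span_base intro: tensor_power_isotypic[OF assms(1)])
  with assms(2) show ?thesis by blast
qed

text \<open>Moving the tensor power to the other side of the inner product yields the tensor power
  of the adjoint, which is again unitary and preserves \<open>HJ J\<close>.\<close>

lemma tensor_power_orth_compl_HJ:
  assumes "unitary_mat U" "x \<in> orth_compl (HJ J)"
  shows "tensor_power U x \<in> orth_compl (HJ J)"
  using assms tensor_power_HJ[OF unitary_mat_cadj[OF assms(1)]]
  by (auto simp: orth_compl_def cinner_tensor_power)

lemma hw_vector_in_isotypic:
  assumes "hw_vector lam \<psi>" shows "\<psi> \<in> isotypic lam"
proof -
  have "tensor_power (mat 1) \<psi> \<in> isotypic lam"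
    unfolding isotypic_def using assms unitary_mat_one by (intro vec.span_base) blast
  then show ?thesis by (simp add: tensor_power_one)
qed

subsection \<open>Dimension of the orthogonal complement of \<open>H_J\<close>\<close>

lemma prod_mat_one_remove:
  fixes f g :: "'k::finite \<Rightarrow> 'd::finite"
  shows "(\<Prod>j\<in>UNIV - {k}. (mat 1 :: complex^'d^'d)$(f j)$(g j)) =
    (if \<forall>j. j \<noteq> k \<longrightarrow> g j = f j then 1 else 0)"
  by (auto simp: mat_def eq_commute[of "g _"])

text \<open>The derived representation of gl(d): \<open>A\<close> acts on one site at a time. The
  matrix unit E_{ab} gives \<open>raising a b\<close>.\<close>

definition lie_action :: "complex^'d^'d \<Rightarrow> complex^('k::finite \<Rightarrow> 'd::finite) \<Rightarrow> complex^('k \<Rightarrow> 'd)" where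
  "lie_action A \<psi> = (\<chi> f. \<Sum>k\<in>UNIV. \<Sum>c\<in>UNIV. A$(f k)$c * \<psi>$(f(k := c)))"

text \<open>By the product rule each term keeps one entry of \<open>A\<close> and identity entries
  elsewhere, so only indices \<open>g\<close> agreeing with \<open>f\<close> off one site
  survive.\<close>

lemma tensor_power_derivative:
  fixes \<psi> :: "complex^('k::finite \<Rightarrow> 'd::finite)"
  shows "((\<lambda>w. tensor_power (mat 1 + cscale w A) \<psi> $ f) has_field_derivative lie_action A \<psi> $ f) (at 0)"
proof -
  have *: "((\<lambda>w. \<Prod>k\<in>UNIV. (mat 1 + cscale w A)$(f k)$(g k)) has_field_derivative
      (\<Sum>k\<in>UNIV. A$(f k)$(g k) * (\<Prod>j\<in>UNIV - {k}. (mat 1 :: complex^'d^'d)$(f j)$(g j)))) (at 0)" for g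
  proof -
    have "((\<lambda>w. (mat 1 + cscale w A)$(f k)$(g k)) has_field_derivative A$(f k)$(g k)) (at 0)" for k
      by (auto simp: cscale_def intro!: derivative_eq_intros)
    from has_field_derivative_prod[of UNIV, OF this] show ?thesis
      by (simp add: cscale_def)
  qed
  have "((\<lambda>w. tensor_power (mat 1 + cscale w A) \<psi> $ f) has_field_derivative
      (\<Sum>g\<in>UNIV. (\<Sum>k\<in>UNIV. A$(f k)$(g k) * (\<Prod>j\<in>UNIV - {k}. (mat 1 :: complex^'d^'d)$(f j)$(g j))) * \<psi>$g)) (at 0)"
    unfolding tensor_power_nth by (intro DERIV_sum DERIV_cmult_right *)
  also have "(\<Sum>g\<in>UNIV. (\<Sum>k\<in>UNIV. A$(f k)$(g k) * (\<Prod>j\<in>UNIV - {k}. (mat 1 :: complex^'d^'d)$(f j)$(g j))) * \<psi>$g)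
      = (\<Sum>k\<in>UNIV. \<Sum>g\<in>{g. \<forall>j. j \<noteq> k \<longrightarrow> g j = f j}. A$(f k)$(g k) * \<psi>$g)"
    unfolding sum_distrib_right
    by (subst sum.swap, intro sum.cong[OF refl] sum.mono_neutral_cong_right)
      (auto simp: prod_mat_one_remove)
  also have "\<dots> = (\<Sum>k\<in>UNIV. \<Sum>c\<in>UNIV. A$(f k)$c * \<psi>$(f(k := c)))"
  proof (rule sum.cong[OF refl])
    fix k
    show "(\<Sum>g\<in>{g. \<forall>j. j \<noteq> k \<longrightarrow> g j = f j}. A$(f k)$(g k) * \<psi>$g) =
      (\<Sum>c\<in>UNIV. A$(f k)$c * \<psi>$(f(k := c)))"
      by (rule sum.reindex_bij_witness[of _ "\<lambda>c. f(k := c)" "\<lambda>g. g k"])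
         (auto intro!: arg_cong2[of _ _ _ _ "(*)"] arg_cong[of _ _ "($) \<psi>"])
  qed
  finally show ?thesis by (simp add: lie_action_def)
qed

text \<open>For \<open>v \<noteq> 0\<close> the condition on \<open>w\<close> says that 1 + w |v|^2,
  the eigenvalue on \<open>v\<close>, is a phase; the orthogonal complement of \<open>v\<close> is
  fixed.\<close>

lemma unitary_mat_rank_one_update:
  fixes v :: "complex^'d"
  assumes "w + cnj w + w * cnj w * of_real ((norm v)\<^sup>2) = 0"
  shows "unitary_mat (mat 1 + cscale w (outer v))"
proof -
  have adj: "cadj (mat 1 + cscale z (outer v)) = mat 1 + cscale (cnj z) (outer v)" for z
    by (auto simp: cadj_def mat_def cscale_def outer_def vec_eq_iff)
  have mult: "(mat 1 + cscale x (outer v)) ** (mat 1 + cscale y (outer v)) =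
      mat 1 + cscale (x + y + x * y * of_real ((norm v)\<^sup>2)) (outer v)" for x y
  proof -
    have "cscale x (outer v) ** cscale y (outer v) = cscale (x * y * cinner v v) (outer v)"
      by (simp add: vec_eq_iff matrix_matrix_mult_def cscale_def outer_def cinner_def
        sum_distrib_left sum_distrib_right mult_ac)
    moreover have "cscale (a + b) (outer v) = cscale a (outer v) + cscale b (outer v)" for a b
      by (simp add: vec_eq_iff cscale_def algebra_simps)
    moreover have "(A + B) ** C = A ** C + B ** C" for A B C :: "complex^'d^'d"
      by (simp add: vec_eq_iff matrix_matrix_mult_def distrib_right sum.distrib)
    ultimately show ?thesis
      by (simp add: matrix_add_ldistrib cinner_self add_ac)
  qed
  have "cscale 0 (outer v) = 0" by (simp add: vec_eq_iff cscale_def)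
  with assms show ?thesis
    unfolding unitary_mat_def adj mult by (simp add: algebra_simps)
qed

text \<open>The function \<open>G\<close> is complex differentiable at 0 and vanishes wherever the
  update is unitary. Such points accumulate at 0, so the derivative, which is the wanted inner
  product, is 0.\<close>

lemma lie_action_outer_orth_compl_HJ:
  fixes x :: "complex^('k::finite \<Rightarrow> 'd::{finite,linorder})"
  assumes x: "x \<in> orth_compl (HJ J)" and v: "v \<noteq> 0"
  shows "lie_action (outer v) x \<in> orth_compl (HJ J)"
  unfolding orth_compl_def
proof clarify
  fix h assume h: "h \<in> (HJ J :: (complex^('k \<Rightarrow> 'd)) set)"
  define G where "G w = cinner h (tensor_power (mat 1 + cscale w (outer v)) x)" for w
  \<comment> \<open>Chosen so that the eigenvalue on \<open>v\<close> is the phase with angle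
    1/(n+1).\<close>
  define W where "W n = (cis (1 / real (Suc n)) - 1) / of_real ((norm v)\<^sup>2)" for n
  have zero: "G (W n) = 0" for n
  proof -
    have "cis t * cnj (cis t) = 1" for t
      by (simp add: cis_cnj cis_mult)
    then have "W n + cnj (W n) + W n * cnj (W n) * of_real ((norm v)\<^sup>2) = 0"
      using v by (simp add: W_def field_simps)
    from tensor_power_orth_compl_HJ[OF unitary_mat_rank_one_update[OF this] x] h
    show ?thesis by (simp add: orth_compl_def G_def)
  qed
  have deriv: "(G has_field_derivative cinner h (lie_action (outer v) x)) (at 0)"
    unfolding G_def cinner_def by (intro DERIV_sum DERIV_cmult tensor_power_derivative)
  have "G 0 = 0"
  proof -
    have "mat 1 + cscale 0 (outer v) = mat 1" by (simp add: vec_eq_iff cscale_def)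
    with x h show ?thesis by (simp add: G_def tensor_power_one orth_compl_def)
  qed
  have lim: "filterlim W (at 0) sequentially"
  proof -
    have "(\<lambda>n. (cis (1 / real (Suc n)) - 1) / of_real ((norm v)\<^sup>2)) \<longlonglongrightarrow> (cis 0 - 1) / of_real ((norm v)\<^sup>2)"
      using v by (intro tendsto_intros LIMSEQ_Suc[OF lim_1_over_n]) auto
    then have "W \<longlonglongrightarrow> 0" by (simp add: W_def[abs_def])
    \<comment> \<open>The angle lies in (0, 1], below pi, so the phase has positive imaginary part
      and differs from 1.\<close>
    moreover have "W n \<noteq> 0" for n
    proof -
      have "sin (1 / real (Suc n)) > 0"
        using pi_gt3 by (intro sin_gt_zero) (auto intro: le_less_trans[of _ 1])
      then have "Im (cis (1 / real (Suc n))) \<noteq> Im 1" by simp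
      then show ?thesis using v unfolding W_def by (metis divide_eq_0_iff eq_iff_diff_eq_0 norm_eq_zero of_real_eq_0_iff power_not_zero)
    qed
    ultimately show ?thesis by (simp add: filterlim_at)
  qed
  have "(\<lambda>n. (G (W n) - G 0) / (W n - 0)) \<longlonglongrightarrow> cinner h (lie_action (outer v) x)"
    by (rule filterlim_compose[OF deriv[unfolded has_field_derivative_iff] lim])
  with zero \<open>G 0 = 0\<close> show "cinner h (lie_action (outer v) x) = 0"
    by (simp add: LIMSEQ_const_iff)
qed

text \<open>Polarization writes the matrix unit E_{ab} as a complex combination of four matrices
  \<open>outer v\<close>, the directions in which unitary curves are at hand.\<close>

lemma raising_polarization:
  assumes "a \<noteq> b"
  shows "raising a b \<psi> = (1/4) *s (lie_action (outer (axis a 1 + axis b 1)) \<psi>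
    - lie_action (outer (axis a 1 - axis b 1)) \<psi>
    + \<i> *s lie_action (outer (axis a 1 + axis b \<i>)) \<psi>
    - \<i> *s lie_action (outer (axis a 1 - axis b \<i>)) \<psi>)"
proof (subst vec_eq_iff, intro allI)
  fix f
  let ?o = "\<lambda>z. outer (axis a 1 + axis b z) :: complex^_^_"
  have o: "(?o 1$i$c - (outer (axis a 1 - axis b 1) :: complex^_^_)$i$c + \<i> * ?o \<i>$i$c
      - \<i> * (outer (axis a 1 - axis b \<i>) :: complex^_^_)$i$c) = (if i = a \<and> c = b then 4 else 0)" for i c
    using assms by (simp add: outer_def axis_def algebra_simps)
  have "(\<Sum>c\<in>UNIV. (if f k = a \<and> c = b then 4 else 0) * \<psi>$(f(k := c))) =
      (if f k = a then 4 * \<psi>$(f(k := b)) else 0)" for k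
    by (simp add: if_distrib[of "\<lambda>c. c * _"] cong: if_cong)
  then have "raising a b \<psi> $ f = (1/4) * (\<Sum>k\<in>UNIV. \<Sum>c\<in>UNIV. (if f k = a \<and> c = b then 4 else 0) * \<psi>$(f(k := c)))"
    by (auto simp: raising_nth sum_distrib_left intro!: sum.cong)
  then show "raising a b \<psi> $ f = ((1/4) *s (lie_action (outer (axis a 1 + axis b 1)) \<psi>
    - lie_action (outer (axis a 1 - axis b 1)) \<psi>
    + \<i> *s lie_action (outer (axis a 1 + axis b \<i>)) \<psi>
    - \<i> *s lie_action (outer (axis a 1 - axis b \<i>)) \<psi>)) $ f"
    unfolding o[symmetric] by (simp add: lie_action_def sum_distrib_left algebra_simps sum.distrib sum_subtractf)
qed

lemma raising_orth_compl_HJ: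
  fixes x :: "complex^('k::finite \<Rightarrow> 'd::{finite,linorder})"
  assumes "a \<noteq> b" "x \<in> orth_compl (HJ J)"
  shows "raising a b x \<in> orth_compl (HJ J)"
proof -
  have nz: "axis a 1 + axis b z \<noteq> (0 :: complex^('d::{finite,linorder}))" "axis a 1 - axis b z \<noteq> (0 :: complex^('d::{finite,linorder}))" for z
    using assms(1) by (auto simp: vec_eq_iff axis_def intro!: exI[of _ a])
  show ?thesis
    unfolding raising_polarization[OF assms(1)]
    by (intro vec.subspace_scale vec.subspace_add vec.subspace_diff subspace_orth_compl
      lie_action_outer_orth_compl_HJ assms(2) nz)
qed


section \<open>Successive kernels of the raising operators\<close>

lemma subspace_kernels_raising:
  assumes "subspace N"
  shows "subspace {x \<in> N. \<forall>(a, b)\<in>S. raising a b x = 0}"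
  using assms unfolding subspace_def
  by (auto simp: case_prod_beta linear_0[OF linear_raising] linear_add[OF linear_raising]
      linear_scale[OF linear_raising])

text \<open>The raising operators are killed one at a time, in an order in which the commutators of the
  current one with those already killed are again killed.\<close>

lemma dim_le_power_mult_dim_kernels_raising:
  fixes N :: "(complex^('k::finite \<Rightarrow> 'd::{finite,linorder})) set"
  assumes N: "subspace N" and inv: "\<And>a b x. a < b \<Longrightarrow> x \<in> N \<Longrightarrow> raising a b x \<in> N"
    and "\<And>a b. (a, b) \<in> S \<Longrightarrow> a < b"
    and "\<And>a b a' b'. (a, b) \<in> S \<Longrightarrow> a' \<le> a \<Longrightarrow> b \<le> b' \<Longrightarrow> (a', b') \<in> S"
  shows "dim N \<le> (CARD('k) + 1) ^ card S * dim {x \<in> N. \<forall>(a, b)\<in>S. raising a b x = 0}"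
  using assms(3,4)
proof (induction "card S" arbitrary: S)
  case 0
  then show ?case by simp
next
  case (Suc n)
  have ne: "S \<noteq> {}" using Suc.hyps(2) by auto
  \<comment> \<open>Take the least second index, then the greatest first index for it. No other pair
    of \<open>S\<close> forces this one by the closure condition, so removing it keeps
    \<open>S\<close> closed.\<close>
  define b where "b = Min (snd ` S)"
  have "b \<in> snd ` S" unfolding b_def using ne by (intro Min_in) auto
  then have neb: "{a. (a, b) \<in> S} \<noteq> {}" by auto
  define a where "a = Max {a. (a, b) \<in> S}"
  have ab: "(a, b) \<in> S" using Max_in[OF _ neb] by (simp add: a_def)
  then have "a < b" by (rule Suc.prems(1))
  have b_min: "b \<le> b'" if "(a', b') \<in> S" for a' b'
    unfolding b_def using that by (intro Min_le) force+
  have a_max: "a' \<le> a" if "(a', b) \<in> S" for a'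
    unfolding a_def using that by (intro Max_ge) auto
  let ?S = "S - {(a, b)}"
  let ?V = "{x \<in> N. \<forall>(a, b)\<in>?S. raising a b x = 0}"
  have card: "n = card ?S" using Suc.hyps(2) ab by simp
  have IH: "dim N \<le> (CARD('k) + 1) ^ card ?S * dim ?V"
  proof (rule Suc.hyps(1)[OF card])
    show "a' < b'" if "(a', b') \<in> ?S" for a' b' using that Suc.prems(1) by blast
    show "(a', b') \<in> ?S" if "(u, v) \<in> ?S" "a' \<le> u" "v \<le> b'" for u v a' b'
      using that Suc.prems(2)[of u v a' b'] b_min[of u v] a_max[of u] by force
  qed
  have killed: "raising c e x = 0" if "x \<in> ?V" "(c, e) \<in> ?S" for x c e
    using that by blast
  have "dim ?V \<le> (CARD('k) + 1) * dim {x \<in> ?V. raising a b x = 0}"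
  proof (intro dim_nilpotent_le linear_raising subspace_kernels_raising N)
    show "raising a b ` ?V \<subseteq> ?V"
    proof clarify
      fix x assume x: "x \<in> N" "\<forall>(a, b)\<in>?S. raising a b x = 0"
      \<comment> \<open>The commutator can only produce E_{ae} (if \<open>b = c\<close>) or E_{cb}
        (if \<open>e = a\<close>). Both pairs belong to \<open>S\<close> by closure and, as
        \<open>c < e\<close>, differ from \<open>(a, b)\<close>, so they already kill
        \<open>x\<close>.\<close>
      have "raising c e (raising a b x) = 0" if ce: "(c, e) \<in> S" "(c, e) \<noteq> (a, b)" for c e
      proof -
        have xce: "raising c e x = 0" using x ce by blast
        have "c < e" using Suc.prems(1) ce by blast
        have "raising a e x = 0" if "b = c"
        proof -
          have "(a, e) \<in> S" using Suc.prems(2)[OF ab, of a e] that \<open>c < e\<close> by auto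
          then show ?thesis using x that \<open>c < e\<close> by auto
        qed
        moreover have "raising c b x = 0" if "e = a"
        proof -
          have "(c, b) \<in> S" using Suc.prems(2)[OF ab, of c b] that \<open>c < e\<close> by auto
          then show ?thesis using x that \<open>c < e\<close> by auto
        qed
        ultimately show ?thesis
          using raising_commutator[of a b c e x] xce
          by (simp add: linear_0[OF linear_raising] split: if_splits)
      qed
      then show "raising a b x \<in> N \<and> (\<forall>(c, e)\<in>?S. raising c e (raising a b x) = 0)"
        using inv[OF \<open>a < b\<close> x(1)] by auto
    qed
    show "(raising a b ^^ (CARD('k) + 1)) x = 0" for x :: "complex^('k \<Rightarrow> 'd)"
      using \<open>a < b\<close> by (intro raising_nilpotent) simp
  qed
  also have "{x \<in> ?V. raising a b x = 0} = {x \<in> N. \<forall>(a, b)\<in>S. raising a b x = 0}"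
    using ab by auto
  finally have "(CARD('k) + 1) ^ card ?S * dim ?V \<le>
      (CARD('k) + 1) ^ card ?S * ((CARD('k) + 1) * dim {x \<in> N. \<forall>(a, b)\<in>S. raising a b x = 0})"
    by (rule mult_left_mono) simp
  note order_trans[OF IH this]
  moreover have "card S = Suc (card ?S)" using Suc.hyps(2) card by simp
  ultimately show ?case by (simp only: power_Suc mult_ac)
qed

lemma card_less_pairs:
  "card {(a, b). a < (b :: 'd::{finite,linorder})} = CARD('d) * (CARD('d) - 1) div 2"
proof -
  let ?L = "{(a, b). a < (b :: 'd)}" and ?G = "{(a, b). b < (a :: 'd)}" and ?D = "range (\<lambda>a :: 'd. (a, a))"
  have "CARD('d) * CARD('d) = card (UNIV \<times> UNIV :: ('d \<times> 'd) set)"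
    by (rule card_cartesian_product[symmetric])
  also have "UNIV \<times> UNIV = ?L \<union> ?G \<union> ?D" by auto
  also have "card (?L \<union> ?G \<union> ?D) = card ?L + card ?G + card ?D"
    by (subst card_Un_disjoint; auto)+
  also have "card ?G = card ?L"
    by (rule bij_betw_same_card[of prod.swap]) (auto simp: bij_betw_def inj_on_def image_iff)
  also have "card ?D = CARD('d)"
    by (rule card_image) (simp add: inj_on_def)
  finally have "2 * card ?L = CARD('d) * (CARD('d) - 1)"
    by (simp add: right_diff_distrib')
  then show ?thesis by simp
qed

text \<open>Restriction to the coordinates in \<open>I\<close> is injective on \<open>S\<close>. The
  factor 2 counts the real directions 1 and \<open>\<i>\<close> in each complex coordinate.\<close>

lemma dim_coordinate_subspace_le:
  fixes S :: "(complex^'n) set"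
  assumes S: "subspace S" and inj: "\<And>x. x \<in> S \<Longrightarrow> (\<And>i. i \<in> I \<Longrightarrow> x $ i = 0) \<Longrightarrow> x = 0"
  shows "dim S \<le> 2 * card I"
proof -
  define r :: "complex^'n \<Rightarrow> complex^'n" where "r x = (\<chi> i. if i \<in> I then x $ i else 0)" for x
  have r: "linear r"
    by (rule linearI) (auto simp: r_def vec_eq_iff)
  have "inj_on r S"
  proof (rule inj_onI)
    fix x y assume xy: "x \<in> S" "y \<in> S" "r x = r y"
    then have "x - y \<in> S" using S by (intro subspace_diff)
    moreover have "(x - y) $ i = 0" if "i \<in> I" for i
      using xy(3) that by (auto simp: r_def vec_eq_iff split: if_splits)
    ultimately show "x = y" using inj[of "x - y"] by simp
  qed
  then have "dim (r ` S) = dim S"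
    using S by (intro dim_image_eq r) (simp add: span_eq_iff[THEN iffD2])
  moreover let ?B = "(\<lambda>i. axis i 1) ` I \<union> (\<lambda>i. axis i \<i>) ` I :: (complex^'n) set"
  have "r ` S \<subseteq> span ?B"
  proof clarify
    fix x
    have "r x = (\<Sum>i\<in>I. Re (x $ i) *\<^sub>R axis i 1 + Im (x $ i) *\<^sub>R axis i \<i>)"
      by (auto simp: r_def vec_eq_iff axis_def complex_eq_iff if_distrib cong: if_cong)
    also have "\<dots> \<in> span ?B"
      by (intro span_sum span_add span_scale span_base) auto
    finally show "r x \<in> span ?B" .
  qed
  then have "dim (r ` S) \<le> card ?B"
    by (rule dim_le_card) simp
  moreover have "card ?B \<le> card I + card I"
    by (intro card_Un_le[THEN order_trans] add_mono card_image_le) auto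
  ultimately show ?thesis by simp
qed

text \<open>A nonzero weight component of \<open>x\<close> is a highest weight vector. Dominance and
  \<open>light\<close> put its weight into \<open>YJ\<close>, so it lies in \<open>HJ J\<close> and
  is orthogonal to \<open>x\<close>; but its inner product with \<open>x\<close> is its own squared
  norm.\<close>

lemma hw_space_orth_compl_HJ_eq_0:
  fixes x :: "complex^('k::finite \<Rightarrow> 'd::{finite,linorder})"
  assumes x: "x \<in> orth_compl (HJ J)" and hw: "\<And>a b. a < b \<Longrightarrow> raising a b x = 0"
    and light: "\<And>f. real (weight_of f (Max UNIV)) < real CARD('k) / real CARD('d) - J \<Longrightarrow> x $ f = 0"
  shows "x = 0"
proof -
  have "weight_component lam x = 0" for lam
  proof (rule ccontr)
    assume nz: "weight_component lam x \<noteq> 0"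
    then obtain f where f: "weight_of f = lam" "x $ f \<noteq> 0"
      by (auto simp: vec_eq_iff weight_component_def split: if_splits)
    note hwc = hw_vector_weight_component[OF hw, of lam]
    have "lam \<in> YJ TYPE('k) J"
      using hw_vector_antimono[OF hwc nz] light[of f] f sum_weight_of[of f]
      by (force simp: YJ_def young_diagrams_def not_less)
    then have "weight_component lam x \<in> HJ J"
      unfolding HJ_def using hw_vector_in_isotypic[OF hwc] by (intro vec.span_base) blast
    then have "cinner (weight_component lam x) x = 0" using x by (simp add: orth_compl_def)
    also have "cinner (weight_component lam x) x = cinner (weight_component lam x) (weight_component lam x)"
      unfolding cinner_def weight_component_def by (intro sum.cong) auto
    finally show False using nz by (simp add: cinner_self)
  qed
  then have "weight_component (weight_of f) x $ f = 0" for f by simp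
  then show ?thesis by (simp add: vec_eq_iff weight_component_def)
qed

lemma dim_orth_compl_HJ_le:
  "dim (orth_compl (HJ J) :: (complex^('k::finite \<Rightarrow> 'd::{finite,linorder})) set) \<le>
    (CARD('k) + 1) ^ (CARD('d) * (CARD('d) - 1) div 2) *
    (2 * card {f :: 'k \<Rightarrow> 'd. real (weight_of f (Max UNIV)) < real CARD('k) / real CARD('d) - J})"
proof -
  let ?N = "orth_compl (HJ J) :: (complex^('k \<Rightarrow> 'd)) set"
  let ?P = "{(a, b). a < (b :: 'd)}"
  have N: "subspace ?N" by (rule vec_subspace_imp_subspace[OF subspace_orth_compl])
  have "dim ?N \<le> (CARD('k) + 1) ^ card ?P * dim {x \<in> ?N. \<forall>(a, b)\<in>?P. raising a b x = 0}"
    by (rule dim_le_power_mult_dim_kernels_raising[OF N]) (auto intro: raising_orth_compl_HJ)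
  also have "\<dots> \<le> (CARD('k) + 1) ^ card ?P *
    (2 * card {f :: 'k \<Rightarrow> 'd. real (weight_of f (Max UNIV)) < real CARD('k) / real CARD('d) - J})"
    by (intro mult_left_mono dim_coordinate_subspace_le subspace_kernels_raising N)
      (auto intro: hw_space_orth_compl_HJ_eq_0)
  finally show ?thesis unfolding card_less_pairs .
qed

section \<open>Hoeffding count of the indices with few letters \<open>m\<close>\<close>

text \<open>Chernoff's method for a uniformly random index, whose sites take the value
  \<open>m\<close> independently with probability 1/d.\<close>

lemma card_light_weight_less:
  fixes m :: "'d::finite" and J :: real
  assumes J: "J \<ge> 0"
  shows "real (card {f :: 'k::finite \<Rightarrow> 'd.
      real (weight_of f m) < real CARD('k) / real CARD('d) - J})
    < real CARD('d) ^ CARD('k) * exp (- 2 * J\<^sup>2 / real CARD('k))"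
proof -
  define K where "K = real CARD('k)"
  define p where "p = 1 / real CARD('d)"
  \<comment> \<open>The minimiser of -sJ + K s^2/8, with minimum -2 J^2/K.\<close>
  define s where "s = 4 * J / K"
  have K: "K > 0" by (simp add: K_def)
  have d: "real CARD('d) \<ge> 1" by simp
  have p: "0 < p" "p \<le> 1" using d by (auto simp: p_def field_simps)
  have s: "s \<ge> 0" using J K by (simp add: s_def)
  define e where "e = (\<lambda>f :: 'k \<Rightarrow> 'd. exp (s * (K * p - J - real (weight_of f m))))"
  let ?bad = "{f :: 'k \<Rightarrow> 'd. real (weight_of f m) < K * p - J}"
  have "real (card ?bad) = (\<Sum>f\<in>UNIV. if f \<in> ?bad then 1 else 0)"
    by (simp add: sum.If_cases)
  also have "\<dots> < (\<Sum>f\<in>UNIV. e f)"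
  proof (rule sum_strict_mono_ex1)
    show "\<forall>f\<in>UNIV. (if f \<in> ?bad then 1 else 0) \<le> e f"
      using s by (auto simp: e_def)
    \<comment> \<open>Strictness comes from the constant index \<open>m\<close>: it has the full
      weight K, hence is not counted, yet contributes a positive exponential.\<close>
    have "K * p - J \<le> K" using mult_left_mono[of p 1 K] J K p by linarith
    then have "(\<lambda>_. m) \<notin> ?bad" by (simp add: weight_of_def K_def)
    then show "\<exists>f\<in>UNIV. (if f \<in> ?bad then 1 else 0) < e f"
      by (intro bexI[of _ "\<lambda>_. m"]) (auto simp: e_def)
  qed simp
  also have "(\<Sum>f\<in>UNIV. e f) = exp (- s * J) * (\<Sum>f\<in>(UNIV :: ('k \<Rightarrow> 'd) set). \<Prod>k\<in>UNIV. exp (s * (p - of_bool (f k = m))))"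
  proof -
    have "e f = exp (- s * J) * (\<Prod>k\<in>UNIV. exp (s * (p - of_bool (f k = m))))" for f :: "'k \<Rightarrow> 'd"
    proof -
      have "(\<Sum>k\<in>UNIV. s * (p - of_bool (f k = m))) = s * (K * p - real (weight_of f m))"
        by (simp add: weight_of_def K_def sum_subtractf of_bool_def sum.If_cases flip: sum_distrib_left)
      then show ?thesis
        by (simp add: e_def algebra_simps flip: exp_sum exp_add)
    qed
    then show ?thesis by (simp add: sum_distrib_left)
  qed
  also have "(\<Sum>f\<in>(UNIV :: ('k \<Rightarrow> 'd) set). \<Prod>k\<in>UNIV. exp (s * (p - of_bool (f k = m)))) =
      (\<Prod>k\<in>(UNIV :: 'k set). \<Sum>i\<in>UNIV. exp (s * (p - of_bool (i = m))))"
    by (rule sum_prod_swap)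
  also have "\<dots> \<le> (real CARD('d) * exp (s\<^sup>2 / 8)) ^ CARD('k)"
  proof -
    have "(\<Sum>i\<in>UNIV. exp (s * (p - of_bool (i = m)))) =
        exp (s * (p - 1)) + real (CARD('d) - 1) * exp (s * p)"
      by (subst sum.remove[of _ m]) (auto simp: card_Diff_singleton)
    \<comment> \<open>Rewritten as d times the centred exponential moment of the indicator of
      \<open>i \<noteq> m\<close>, which has mean 1 - p; this is the form bounded in Hoeffding's
      lemma.\<close>
    also have "\<dots> = real CARD('d) * (exp (- s * (1 - p)) * (1 + (1 - p) * (exp s - 1)))"
    proof -
      have "exp (s * p) = exp (- s * (1 - p)) * exp s" by (simp add: algebra_simps flip: exp_add)
      moreover have "real CARD('d) * p = 1" by (simp add: p_def)
      moreover have "real (CARD('d) - 1) = real CARD('d) - 1" using d by (simp add: of_nat_diff)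
      moreover have "exp (s * (p - 1)) = exp (- s * (1 - p))" by (simp add: algebra_simps)
      ultimately show ?thesis by algebra
    qed
    also have "exp (- s * (1 - p)) * (1 + (1 - p) * (exp s - 1)) \<le> exp (s\<^sup>2 / 8)"
    proof -
      have pos: "0 < 1 + (1 - p) * (exp s - 1)"
        using p s by (intro add_pos_nonneg mult_nonneg_nonneg) auto
      have "- s * (1 - p) + ln (1 + (1 - p) * (exp s - 1)) \<le> s\<^sup>2 / 8"
        using Hoeffdings_lemma_aux[of s "1 - p"] s p by simp
      then have "exp (- s * (1 - p) + ln (1 + (1 - p) * (exp s - 1))) \<le> exp (s\<^sup>2 / 8)" by simp
      then show ?thesis using pos by (simp only: exp_add exp_ln)
    qed
    finally show ?thesis
      by (simp add: power_mono sum_nonneg)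
  qed
  also have "exp (- s * J) * (real CARD('d) * exp (s\<^sup>2 / 8)) ^ CARD('k) =
      real CARD('d) ^ CARD('k) * exp (- s * J + K * (s\<^sup>2 / 8))"
    unfolding exp_add K_def by (simp add: power_mult_distrib flip: exp_of_nat_mult)
  also have "- s * J + K * (s\<^sup>2 / 8) = - 2 * J\<^sup>2 / K"
    using K by (simp add: s_def field_simps power2_eq_square)
  finally show ?thesis by (simp add: K_def p_def)
qed

subsection \<open>Projections, fidelity and second moments\<close>

text \<open>Uniqueness for the \<open>THE\<close>: the difference of two candidates lies in
  \<open>H\<close> and is orthogonal to itself.\<close>

lemma orth_proj_eqI:
  assumes H: "vec.subspace H" and p: "p \<in> H" "\<psi> - p \<in> orth_compl H"
  shows "orth_proj H \<psi> = p"
  unfolding orth_proj_def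
proof (rule the_equality)
  show "p \<in> H \<and> (\<forall>h\<in>H. cinner h (\<psi> - p) = 0)"
    using p by (auto simp: orth_compl_def)
  fix p' assume p': "p' \<in> H \<and> (\<forall>h\<in>H. cinner h (\<psi> - p') = 0)"
  then have "p' - p \<in> H" using p H by (simp add: vec.subspace_diff)
  then have "cinner (p' - p) (\<psi> - p) = 0" "cinner (p' - p) (\<psi> - p') = 0"
    using p p' by (auto simp: orth_compl_def)
  then have "cinner (p' - p) ((\<psi> - p) - (\<psi> - p')) = 0"
    by (simp only: cinner_diff_right) simp
  then show "p' = p" by (simp add: cinner_self)
qed

text \<open>The real orthogonal decomposition controls only real parts of \<open>cinner\<close>.
  Testing with \<open>\<i> *s h\<close>, also in \<open>H\<close>, gives the imaginary
  parts.\<close>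

lemma orth_proj:
  assumes H: "vec.subspace H"
  shows orth_proj_in: "orth_proj H \<psi> \<in> H"
    and diff_orth_proj_in: "\<psi> - orth_proj H \<psi> \<in> orth_compl H"
proof -
  have "span H = H" using vec_subspace_imp_subspace[OF H] by (rule span_eq_iff[THEN iffD2])
  then obtain y z where y: "y \<in> H" and z: "\<And>w. w \<in> H \<Longrightarrow> orthogonal z w" and \<psi>: "\<psi> = y + z"
    using orthogonal_subspace_decomp_exists[of H \<psi>] by metis
  have "cinner h z = 0" if "h \<in> H" for h
  proof (rule complex_eqI)
    have Re: "Re (cinner w z) = 0" if "w \<in> H" for w
      using z[OF that] by (simp add: Re_cinner orthogonal_def inner_commute)
    show "Re (cinner h z) = Re 0" using Re[OF that] by simp
    have "Re (cinner (\<i> *s h) z) = 0" using H that by (intro Re vec.subspace_scale)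
    then show "Im (cinner h z) = Im 0" by (simp add: cinner_scale_left)
  qed
  then have "orth_proj H \<psi> = y"
    using y \<psi> by (intro orth_proj_eqI[OF H]) (auto simp: orth_compl_def)
  with y \<psi> \<open>\<And>h. h \<in> H \<Longrightarrow> cinner h z = 0\<close>
  show "orth_proj H \<psi> \<in> H" "\<psi> - orth_proj H \<psi> \<in> orth_compl H"
    by (auto simp: orth_compl_def)
qed

lemma proj_mat_mult:
  assumes H: "vec.subspace H"
  shows "proj_mat H *v \<psi> = orth_proj H \<psi>"
proof (rule orth_proj_eqI[OF H, symmetric])
  have eq: "proj_mat H *v \<psi> = (\<Sum>j\<in>UNIV. \<psi> $ j *s orth_proj H (axis j 1))"
    by (simp add: vec_eq_iff proj_mat_def matrix_vector_mult_def mult.commute)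
  show "proj_mat H *v \<psi> \<in> H"
    unfolding eq by (intro vec.subspace_sum vec.subspace_scale H orth_proj_in)
  have "\<psi> - proj_mat H *v \<psi> = (\<Sum>j\<in>UNIV. \<psi> $ j *s (axis j 1 - orth_proj H (axis j 1)))"
    unfolding eq vec.scale_right_diff_distrib sum_subtractf by (simp add: basis_expansion)
  also have "\<dots> \<in> orth_compl H"
    by (intro vec.subspace_sum vec.subspace_scale subspace_orth_compl diff_orth_proj_in H)
  finally show "\<psi> - proj_mat H *v \<psi> \<in> orth_compl H" .
qed

text \<open>The projected term contributes |p|^4 = (1 - |q|^2)^2, and the replacement term is
  nonnegative because \<open>\<rho>0\<close> is positive semidefinite.\<close>

lemma fidelity_proj_mat_ge:
  assumes H: "vec.subspace H" and \<rho>: "density_matrix \<rho>0" and \<psi>: "norm \<psi> = 1"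
  shows "Re (fidelity (proj_mat H) \<rho>0 \<psi>) \<ge> 1 - 2 * (norm (\<psi> - orth_proj H \<psi>))\<^sup>2"
proof -
  define p where "p = orth_proj H \<psi>"
  define q where "q = \<psi> - p"
  have \<psi>_eq: "\<psi> = p + q" by (simp add: q_def)
  have pq: "cinner p q = 0"
    using orth_proj[OF H, of \<psi>] by (simp add: p_def q_def orth_compl_def)
  then have qp: "cinner q p = 0" by (subst cinner_commute) simp
  have "of_real ((norm \<psi>)\<^sup>2) = (of_real ((norm p)\<^sup>2 + (norm q)\<^sup>2) :: complex)"
    unfolding cinner_self[symmetric] of_real_add
    by (subst (1 2) \<psi>_eq) (simp add: cinner_add_left cinner_add_right pq qp)
  then have norms: "(norm p)\<^sup>2 = 1 - (norm q)\<^sup>2"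
    using \<psi> by (simp only: of_real_eq_iff) simp
  have \<psi>p: "cinner \<psi> p = of_real ((norm p)\<^sup>2)"
    by (subst \<psi>_eq) (simp add: cinner_add_left qp cinner_self)
  have \<psi>q: "cinner \<psi> q = of_real ((norm q)\<^sup>2)"
    by (subst \<psi>_eq) (simp add: cinner_add_left pq cinner_self)
  have P: "proj_mat H *v \<psi> = p" by (simp add: proj_mat_mult[OF H] p_def)
  have outer: "outer \<psi> *v x = cinner \<psi> x *s \<psi>" for x
    by (simp add: vec_eq_iff outer_def cinner_def matrix_vector_mult_def sum_distrib_left mult_ac)
  have "ctrace (A ** outer \<psi>) = cinner \<psi> (A *v \<psi>)" for A
    by (simp add: ctrace_def matrix_matrix_mult_def outer_def cinner_def matrix_vector_mult_def
        sum_distrib_left mult_ac)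
  then have tr: "ctrace ((mat 1 - proj_mat H) ** outer \<psi>) = of_real ((norm q)\<^sup>2)"
    by (simp add: matrix_vector_mult_diff_rdistrib P \<psi>q flip: q_def)
  have "cscale c A *v x = c *s (A *v x)" for c A and x :: "complex^'a"
    by (simp add: vec_eq_iff cscale_def matrix_vector_mult_def sum_distrib_left mult_ac)
  then have "channel (proj_mat H) \<rho>0 (outer \<psi>) *v \<psi> =
      of_real ((norm p)\<^sup>2) *s p + of_real ((norm q)\<^sup>2) *s (\<rho>0 *v \<psi>)"
    unfolding channel_def matrix_vector_mult_add_rdistrib tr
    by (simp add: P outer \<psi>p vector_scalar_commute flip: matrix_vector_mul_assoc)
  then have "fidelity (proj_mat H) \<rho>0 \<psi> =
      of_real ((norm p)\<^sup>2 * (norm p)\<^sup>2) + of_real ((norm q)\<^sup>2) * cinner \<psi> (\<rho>0 *v \<psi>)"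
    by (simp add: fidelity_def cinner_add_right cinner_scale_right \<psi>p)
  then have "Re (fidelity (proj_mat H) \<rho>0 \<psi>) =
      (norm p)\<^sup>2 * (norm p)\<^sup>2 + (norm q)\<^sup>2 * Re (cinner \<psi> (\<rho>0 *v \<psi>))"
    by (simp only: plus_complex.sel Re_complex_of_real) simp
  moreover have "Re (cinner \<psi> (\<rho>0 *v \<psi>)) \<ge> 0" using \<rho> by (simp add: density_matrix_def)
  ultimately have "Re (fidelity (proj_mat H) \<rho>0 \<psi>) \<ge> (norm p)\<^sup>2 * (norm p)\<^sup>2" by simp
  then have "Re (fidelity (proj_mat H) \<rho>0 \<psi>) \<ge> (1 - (norm q)\<^sup>2)\<^sup>2"
    by (simp only: norms power2_eq_square[of "1 - (norm q)\<^sup>2"])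
  moreover have "(1 - (norm q)\<^sup>2)\<^sup>2 \<ge> 1 - 2 * (norm q)\<^sup>2"
    by (simp add: power2_diff)
  ultimately show ?thesis by (simp add: q_def p_def)
qed

section \<open>Second moments of a unitarily invariant random unit vector\<close>

text \<open>Permutations with phases are the unitaries through which invariance enters the moment
  computation.\<close>

lemma unitary_monomial_mat:
  fixes \<tau> :: "'n::finite \<Rightarrow> 'n"
  assumes "inj \<tau>" "\<And>a. c a * cnj (c a) = 1"
  defines "W \<equiv> \<chi> a b. if b = \<tau> a then c a else 0"
  shows "unitary_mat W" and "(W *v \<psi>) $ a = c a * \<psi> $ \<tau> a"
proof -
  have "W ** cadj W = mat 1"
    using assms(1,2)
    by (auto simp: W_def cadj_def mat_def vec_eq_iff matrix_matrix_mult_def if_distrib[of "\<lambda>x. x * _"]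
        inj_eq cong: if_cong)
  then show "unitary_mat W" by (simp add: unitary_mat_def matrix_left_right_inverse)
  show "(W *v \<psi>) $ a = c a * \<psi> $ \<tau> a"
    by (simp add: W_def matrix_vector_mult_def if_distrib[of "\<lambda>x. x * _"] cong: if_cong)
qed

context
  fixes \<mu> :: "(complex^'n::finite) measure"
  assumes prob: "prob_space \<mu>" and sets: "sets \<mu> = sets borel"
    and norm1: "AE \<psi> in \<mu>. norm \<psi> = 1"
    and unitary: "\<And>W :: complex^'n^'n. unitary_mat W \<Longrightarrow> distr \<mu> borel ((*v) W) = \<mu>"
begin

interpretation prob_space \<mu> by (rule prob)

lemma borel_measurable_continuous:
  "continuous_on UNIV f \<Longrightarrow> f \<in> borel_measurable \<mu>"
  for f :: "complex^'n \<Rightarrow> 'b::topological_space"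
  using borel_measurable_continuous_onI measurable_cong_sets[OF sets refl] by blast

lemma integral_monomial:
  fixes f :: "complex^'n \<Rightarrow> 'b::{banach,second_countable_topology}"
  assumes "continuous_on UNIV f" "inj \<tau>" "\<And>a. c a * cnj (c a) = 1"
  shows "(\<integral>\<psi>. f (\<chi> a. c a * \<psi> $ \<tau> a) \<partial>\<mu>) = (\<integral>\<psi>. f \<psi> \<partial>\<mu>)"
proof -
  let ?W = "\<chi> a b. if b = \<tau> a then c a else 0"
  have "(\<integral>\<psi>. f \<psi> \<partial>\<mu>) = (\<integral>\<psi>. f \<psi> \<partial>distr \<mu> borel ((*v) ?W))"
    using unitary[OF unitary_monomial_mat(1)[OF assms(2,3)]] by simp
  also have "\<dots> = (\<integral>\<psi>. f (?W *v \<psi>) \<partial>\<mu>)"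
    by (intro integral_distr borel_measurable_continuous borel_measurable_continuous_onI assms(1)
      linear_continuous_on) (auto intro: matrix_vector_mul_bounded_linear)
  also have "(\<lambda>\<psi>. ?W *v \<psi>) = (\<lambda>\<psi>. \<chi> a. c a * \<psi> $ \<tau> a)"
    using unitary_monomial_mat(2)[OF assms(2,3)] by (auto simp: vec_eq_iff)
  finally show ?thesis by metis
qed

lemma integrable_bounded_sphere:
  fixes f :: "complex^'n \<Rightarrow> 'b::{banach,second_countable_topology}"
  assumes "continuous_on UNIV f" "\<And>\<psi>. norm \<psi> = 1 \<Longrightarrow> norm (f \<psi>) \<le> B"
  shows "integrable \<mu> f"
  using norm1 assms
  by (intro integrable_const_bound[of _ B] borel_measurable_continuous) (auto elim!: eventually_mono)

text \<open>Flipping the sign of coordinate \<open>i\<close> makes an off-diagonal moment its own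
  negative. Transpositions make the diagonal moments equal, and they sum to the squared norm
  1.\<close>

lemma second_moment_coordinates:
  shows "integrable \<mu> (\<lambda>\<psi>. \<psi> $ i * cnj (\<psi> $ j))"
    and "(\<integral>\<psi>. \<psi> $ i * cnj (\<psi> $ j) \<partial>\<mu>) = (if i = j then 1 / of_nat CARD('n) else 0)"
proof -
  let ?m = "\<lambda>i j. \<integral>\<psi>. \<psi> $ i * cnj (\<psi> $ j) \<partial>\<mu>"
  have cont: "continuous_on UNIV (\<lambda>\<psi> :: complex^'n. \<psi> $ i * cnj (\<psi> $ j))" for i j
    by (intro continuous_intros)
  have int: "integrable \<mu> (\<lambda>\<psi>. \<psi> $ i * cnj (\<psi> $ j))" for i j
  proof (rule integrable_bounded_sphere[OF cont])
    fix \<psi> :: "complex^'n" assume "norm \<psi> = 1"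
    then have "norm (\<psi> $ i) \<le> 1" "norm (\<psi> $ j) \<le> 1"
      using Finite_Cartesian_Product.norm_nth_le[of \<psi>] by metis+
    then show "norm (\<psi> $ i * cnj (\<psi> $ j)) \<le> 1"
      by (simp add: norm_mult mult_le_one)
  qed
  then show "integrable \<mu> (\<lambda>\<psi>. \<psi> $ i * cnj (\<psi> $ j))" .
  have off: "?m i j = 0" if "i \<noteq> j" for i j
  proof -
    have "?m i j = - ?m i j"
      using integral_monomial[OF cont[of i j], of id "\<lambda>a. if a = i then -1 else 1"] that
      by (simp add: if_distrib cong: if_cong)
    then show ?thesis by simp
  qed
  have diag: "?m i i = ?m j j" for i j
    using integral_monomial[OF cont[of i i], of "Transposition.transpose i j" "\<lambda>_. 1"] by simp
  have "(\<Sum>j\<in>UNIV. ?m j j) = (\<integral>\<psi>. (\<Sum>j\<in>UNIV. \<psi> $ j * cnj (\<psi> $ j)) \<partial>\<mu>)"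
    using int by simp
  also have "\<dots> = (\<integral>\<psi>. 1 \<partial>\<mu>)"
  proof (rule integral_cong_AE)
    show "AE \<psi> in \<mu>. (\<Sum>j\<in>UNIV. \<psi> $ j * cnj (\<psi> $ j)) = 1"
      using norm1
    proof eventually_elim
      fix \<psi> :: "complex^'n" assume "norm \<psi> = 1"
      then have "cinner \<psi> \<psi> = 1" by (simp add: cinner_self)
      then show "(\<Sum>j\<in>UNIV. \<psi> $ j * cnj (\<psi> $ j)) = 1" by (simp add: cinner_def mult.commute)
    qed
  qed (use int in auto)
  also have "\<dots> = 1" by (simp add: prob_space)
  also have "(\<Sum>j\<in>UNIV. ?m j j) = of_nat CARD('n) * ?m i i"
    by (subst sum.cong[OF refl diag[of _ i]]) simp
  finally show "?m i j = (if i = j then 1 / of_nat CARD('n) else 0)"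
    using off[of i j] by (auto simp: field_simps)
qed

text \<open>Multiplication by \<open>\<i>\<close> is unitary and exchanges the squares of the real
  and imaginary parts of \<open>cinner u \<psi>\<close>, so the real inner product carries half of
  the complex moment 1/n.\<close>

lemma second_moment:
  fixes u :: "complex^'n"
  assumes u: "norm u = 1"
  shows "integrable \<mu> (\<lambda>\<psi>. (u \<bullet> \<psi>)\<^sup>2)"
    and "(\<integral>\<psi>. (u \<bullet> \<psi>)\<^sup>2 \<partial>\<mu>) = 1 / (2 * real CARD('n))"
proof -
  have cont_c: "continuous_on UNIV (cinner u)"
    unfolding cinner_def by (intro continuous_intros)
  then have cont: "continuous_on UNIV (\<lambda>\<psi>. (Re (cinner u \<psi>))\<^sup>2)" "continuous_on UNIV (\<lambda>\<psi>. (Im (cinner u \<psi>))\<^sup>2)"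
    by (auto intro!: continuous_intros)
  have Im: "Im (cinner u \<psi>) = - Re (cinner u (\<i> *s \<psi>))" for \<psi> by (simp add: cinner_scale_right)
  have bound: "\<bar>Re (cinner u \<psi>)\<bar> \<le> norm \<psi>" for \<psi>
    unfolding Re_cinner using Cauchy_Schwarz_ineq2[of u \<psi>] u by simp
  have norm_i: "norm (\<i> *s \<psi>) = norm \<psi>" for \<psi> :: "complex^'n"
    by (simp add: norm_vec_def norm_mult)
  have sq: "(Re (cinner u \<psi>))\<^sup>2 \<le> 1" "(Im (cinner u \<psi>))\<^sup>2 \<le> 1" if "norm \<psi> = 1" for \<psi>
    using bound[of \<psi>] bound[of "\<i> *s \<psi>"] that by (simp_all add: Im abs_square_le_1 norm_i)
  have int: "integrable \<mu> (\<lambda>\<psi>. (Re (cinner u \<psi>))\<^sup>2)" "integrable \<mu> (\<lambda>\<psi>. (Im (cinner u \<psi>))\<^sup>2)"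
    using sq by (auto intro!: integrable_bounded_sphere[OF cont(1)] integrable_bounded_sphere[OF cont(2)])
  then show "integrable \<mu> (\<lambda>\<psi>. (u \<bullet> \<psi>)\<^sup>2)" by (simp add: Re_cinner)
  have "(\<integral>\<psi>. (Re (cinner u \<psi>))\<^sup>2 \<partial>\<mu>) = (\<integral>\<psi>. (Im (cinner u \<psi>))\<^sup>2 \<partial>\<mu>)"
  proof -
    have "(\<chi> a. \<i> * \<psi> $ id a) = \<i> *s \<psi>" for \<psi> :: "complex^'n" by (simp add: vec_eq_iff)
    then show ?thesis
      using integral_monomial[OF cont(1), of id "\<lambda>_. \<i>"] by (simp add: cinner_scale_right)
  qed
  then have "complex_of_real (2 * (\<integral>\<psi>. (Re (cinner u \<psi>))\<^sup>2 \<partial>\<mu>)) =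
      complex_of_real (\<integral>\<psi>. (Re (cinner u \<psi>))\<^sup>2 + (Im (cinner u \<psi>))\<^sup>2 \<partial>\<mu>)"
    using int by simp
  also have "\<dots> = (\<integral>\<psi>. complex_of_real ((Re (cinner u \<psi>))\<^sup>2 + (Im (cinner u \<psi>))\<^sup>2) \<partial>\<mu>)"
    by (rule integral_complex_of_real[symmetric])
  also have "\<dots> = (\<integral>\<psi>. (\<Sum>i\<in>UNIV. \<Sum>j\<in>UNIV. cnj (u $ i) * u $ j * (\<psi> $ i * cnj (\<psi> $ j))) \<partial>\<mu>)"
  proof -
    have "complex_of_real ((Re z)\<^sup>2 + (Im z)\<^sup>2) = z * cnj z" for z
      by (simp add: complex_mult_cnj)
    then show ?thesis
      unfolding cinner_def by (simp only: cnj_sum sum_product) (simp add: mult_ac)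
  qed
  also have "\<dots> = (\<Sum>i\<in>UNIV. \<Sum>j\<in>UNIV. cnj (u $ i) * u $ j * (if i = j then 1 / of_nat CARD('n) else 0))"
    by (simp add: second_moment_coordinates integrable_sum)
  also have "\<dots> = cinner u u / of_nat CARD('n)"
    by (simp add: cinner_def sum_divide_distrib if_distrib cong: if_cong)
  also have "\<dots> = complex_of_real (1 / real CARD('n))"
    using u by (simp add: cinner_self)
  finally have "2 * (\<integral>\<psi>. (Re (cinner u \<psi>))\<^sup>2 \<partial>\<mu>) = 1 / real CARD('n)"
    by (simp only: of_real_eq_iff)
  then show "(\<integral>\<psi>. (u \<bullet> \<psi>)\<^sup>2 \<partial>\<mu>) = 1 / (2 * real CARD('n))"
    by (simp add: Re_cinner field_simps)
qed

end

section \<open>Expected mass in the complement and the tail bound\<close>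

text \<open>Parseval's identity: by orthonormality the expansion coefficients of \<open>x\<close>
  are its inner products with \<open>B\<close>.\<close>

lemma sum_inner_orthonormal_eq_norm_square:
  fixes x :: "'a::euclidean_space"
  assumes B: "pairwise orthogonal B" "\<And>u. u \<in> B \<Longrightarrow> norm u = 1" "independent B"
    and x: "x \<in> span B"
  shows "(\<Sum>u\<in>B. (u \<bullet> x)\<^sup>2) = (norm x)\<^sup>2"
proof -
  have fin: "finite B" using B(3) by (rule independent_imp_finite)
  obtain c where c: "x = (\<Sum>u\<in>B. c u *\<^sub>R u)"
    using x by (auto simp: span_finite[OF fin])
  have "u \<bullet> x = c u" if "u \<in> B" for u
  proof -
    have "u \<bullet> x = (\<Sum>w\<in>B. if w = u then c u else 0)"
      unfolding c inner_sum_right using B(1,2) that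
      by (intro sum.cong) (auto simp: pairwise_def orthogonal_def norm_eq_1)
    then show ?thesis using fin that by simp
  qed
  then have "(\<Sum>u\<in>B. (u \<bullet> x)\<^sup>2) = (\<Sum>u\<in>B. c u * (u \<bullet> x))"
    by (intro sum.cong) (auto simp: power2_eq_square)
  also have "\<dots> = x \<bullet> x" by (subst (2) c) (simp add: inner_sum_left)
  finally show ?thesis by (simp add: power2_norm_eq_inner)
qed

theorem theorem2:
  fixes \<mu> :: "(complex^('k::finite \<Rightarrow> 'd::{finite,linorder})) measure"
    and J \<epsilon> :: real
    and \<rho>0 :: "complex^('k \<Rightarrow> 'd)^('k \<Rightarrow> 'd)"
  assumes "CARD('d) \<ge> 2"
    and "J \<ge> 0" and "\<epsilon> > 0"
    and "density_matrix \<rho>0"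
    and "\<forall>v. \<rho>0 *v v \<in> (HJ J :: (complex^('k \<Rightarrow> 'd)) set)"
    and "prob_space \<mu>" and "sets \<mu> = sets borel"
    and "AE \<psi> in \<mu>. norm \<psi> = 1"
    and "\<forall>W :: complex^('k \<Rightarrow> 'd)^('k \<Rightarrow> 'd). unitary_mat W \<longrightarrow> distr \<mu> borel ((*v) W) = \<mu>"
  shows "measure \<mu> {\<psi>. Re (fidelity (PJ J) \<rho>0 \<psi>) < 1 - \<epsilon>}
     < 2 * (real CARD('k) + 1) ^ (CARD('d) * (CARD('d) - 1) div 2) / \<epsilon>
       * exp (- 2 * J^2 / real CARD('k))"
proof -
  interpret prob_space \<mu> by fact
  let ?H = "HJ J :: (complex^('k \<Rightarrow> 'd)) set"
  let ?N = "orth_compl ?H"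
  let ?D = "CARD('d) * (CARD('d) - 1) div 2"
  let ?d = "real CARD('d) ^ CARD('k)"
  define bad where
    "bad = {f :: 'k \<Rightarrow> 'd. real (weight_of f (Max UNIV)) < real CARD('k) / real CARD('d) - J}"
  have space: "space \<mu> = UNIV" using sets_eq_imp_space_eq[OF \<open>sets \<mu> = sets borel\<close>] by simp
  have "subspace ?N" by (rule vec_subspace_imp_subspace[OF subspace_orth_compl])
  then obtain B where B: "B \<subseteq> ?N" "pairwise orthogonal B" "\<And>u. u \<in> B \<Longrightarrow> norm u = 1"
      "independent B" "card B = dim ?N" "span B = ?N"
    using orthonormal_basis_subspace by metis
  \<comment> \<open>Expanding the squared norm of the complement part in a real orthonormal basis
    makes its expectation computable term by term.\<close>
  define Q where "Q \<psi> = (\<Sum>u\<in>B. (u \<bullet> \<psi>)\<^sup>2)" for \<psi>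
  have Q: "Q \<psi> = (norm (\<psi> - orth_proj ?H \<psi>))\<^sup>2" for \<psi>
  proof -
    have "u \<bullet> orth_proj ?H \<psi> = 0" if "u \<in> B" for u
    proof -
      have "cinner (orth_proj ?H \<psi>) u = 0"
        using that B(1) orth_proj_in[OF subspace_HJ, of J \<psi>] by (auto simp: orth_compl_def)
      then show ?thesis by (metis Re_cinner inner_commute zero_complex.sel(1))
    qed
    then have "Q \<psi> = (\<Sum>u\<in>B. (u \<bullet> (\<psi> - orth_proj ?H \<psi>))\<^sup>2)"
      by (simp add: Q_def inner_diff_right)
    also have "\<dots> = (norm (\<psi> - orth_proj ?H \<psi>))\<^sup>2"
      using diff_orth_proj_in[OF subspace_HJ, of \<psi> J] B
      by (intro sum_inner_orthonormal_eq_norm_square) auto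
    finally show ?thesis .
  qed
  have "distr \<mu> borel ((*v) W) = \<mu>" if "unitary_mat W" for W :: "complex^('k \<Rightarrow> 'd)^('k \<Rightarrow> 'd)"
    using assms(9) that by blast
  note moment = second_moment[OF \<open>prob_space \<mu>\<close> assms(7,8) this]
  have int: "integrable \<mu> Q" unfolding Q_def using moment(1) B(3) by (intro Bochner_Integration.integrable_sum) auto
  have "CARD('k \<Rightarrow> 'd) = CARD('d) ^ CARD('k)" by (simp add: card_fun)
  then have "(\<integral>\<psi>. Q \<psi> \<partial>\<mu>) = real (dim ?N) / (2 * ?d)"
    unfolding Q_def using moment B(3,5) by (subst Bochner_Integration.integral_sum) auto
  \<comment> \<open>The 2 from the real dimension cancels against the 2 in the real second
    moment.\<close>
  also have "\<dots> \<le> real ((CARD('k) + 1) ^ ?D * (2 * card bad)) / (2 * ?d)"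
    unfolding bad_def by (intro divide_right_mono of_nat_mono dim_orth_compl_HJ_le) simp
  also have "\<dots> = (real CARD('k) + 1) ^ ?D * (real (card bad) / ?d)"
    by (simp add: add.commute)
  also have "\<dots> < (real CARD('k) + 1) ^ ?D * exp (- 2 * J\<^sup>2 / real CARD('k))"
    using card_light_weight_less[OF \<open>J \<ge> 0\<close>, of "Max UNIV :: 'd", where ?'k = 'k]
    by (intro mult_strict_left_mono) (auto simp: bad_def field_simps)
  finally have expectation_Q: "(\<integral>\<psi>. Q \<psi> \<partial>\<mu>) < (real CARD('k) + 1) ^ ?D * exp (- 2 * J\<^sup>2 / real CARD('k))" .
  \<comment> \<open>On unit vectors the fidelity is at least 1 - 2 \<open>Q \<psi>\<close>, so
    falling below 1 - \<open>\<epsilon>\<close> forces \<open>Q \<psi>\<close> above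
    \<open>\<epsilon> / 2\<close>.\<close>
  have "measure \<mu> {\<psi>. Re (fidelity (PJ J) \<rho>0 \<psi>) < 1 - \<epsilon>} \<le> measure \<mu> {\<psi> \<in> space \<mu>. \<epsilon> / 2 \<le> Q \<psi>}"
  proof (rule finite_measure_mono_AE)
    show "AE \<psi> in \<mu>. \<psi> \<in> {\<psi>. Re (fidelity (PJ J) \<rho>0 \<psi>) < 1 - \<epsilon>} \<longrightarrow> \<psi> \<in> {\<psi> \<in> space \<mu>. \<epsilon> / 2 \<le> Q \<psi>}"
      using assms(8)
    proof eventually_elim
      case (elim \<psi>)
      then show ?case
        using fidelity_proj_mat_ge[OF subspace_HJ[of J] \<open>density_matrix \<rho>0\<close> elim]
        by (auto simp: space PJ_def Q)
    qed
    show "{\<psi> \<in> space \<mu>. \<epsilon> / 2 \<le> Q \<psi>} \<in> sets \<mu>"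
      using int by measurable
  qed
  \<comment> \<open>Markov's inequality at threshold \<open>\<epsilon> / 2\<close> is the source of
    the prefactor 2/\<open>\<epsilon>\<close>.\<close>
  also have "\<dots> \<le> (\<integral>\<psi>. Q \<psi> \<partial>\<mu>) / (\<epsilon> / 2)"
  proof -
    have "Q \<psi> \<ge> 0" for \<psi> by (simp add: Q)
    then show ?thesis
      using int \<open>\<epsilon> > 0\<close> by (intro integral_Markov_inequality_measure[where A = "{}"]) auto
  qed
  also have "\<dots> < (real CARD('k) + 1) ^ ?D * exp (- 2 * J\<^sup>2 / real CARD('k)) / (\<epsilon> / 2)"
    using expectation_Q \<open>\<epsilon> > 0\<close> by (intro divide_strict_right_mono) auto
  finally show ?thesis by (simp add: mult_ac)
qed

end
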